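(* Let $X$ be a real vector space and let $C, D \subseteq X$ be convex sets with homogenization cones $K := \operatorname{cone}(C \times \{1\})$ and $G := \operatorname{cone}(D \times \{1\})$ in $X \times \mathbb{R}$. Then the following sets are equal (their common value is the generated face $F_C(D)$): 1. The smallest face of $C$ that contains $C \cap D$. 2. $\gamma_1^{-1}(F_K(G))$. 3. $\min_{\operatorname{cone}(C-D)} C$ when $C \cap D \neq \varnothing$, and $\varnothing$ otherwise. 4. $\min_{\operatorname{cone}(C - (C \cap D))} C$ when $C \cap D \neq \varnothing$, and $\varnothing$ otherwise.
   Context: Vector spaces are real, of arbitrary (possibly infinite) dimension, with no topology. A convex cone contains the origin and is closed under addition and under multiplication by positive scalars; it is pointed if $K \cap (-K) = \{0\}$. $\operatorname{cone}(S) := \{\lambda s \mid \lambda \ge 0, s \in S\}$, with the convention $\operatorname{cone}(\varnothing) = \{0\}$. $\gamma_1: X \to X \times \mathbb{R}$ is $\gamma_1(x) := (x,1)$. A preorder is identified with its positive cone, a convex cone $P$, via $x \le_P y \iff y-x \in P$; $\min_P S := \{s \in S \mid s \le_P s' \text{ for all } s' \in S\}$. An oriented linear (resp. affine) map $f: W \to (Y,Y_+)$ is a linear (resp. affine) map from a real vector space $W$ to a real vector space $Y$ equipped with a pointed convex cone $Y_+ \subseteq Y$; it is positive on $S$ if $f(S) \subseteq Y_+$; $\ker f := f^{-1}(0)$. A face of a convex cone $K \subseteq W$ is a set $K \cap \ker \psi$ for an oriented linear map $\psi$ on $W$ that is positive on $K$. A face of a convex set $C \subseteq X$ is a set $C \cap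 \ker f$ for an oriented affine map $f$ on $X$ that is positive on $C$ (so $\varnothing$ is a face of a convex set). For convex cones $K, G \subseteq W$, $F_K(G)$ denotes the smallest (with respect to inclusion) face of $K$ (as a convex cone) that contains $K \cap G$. *)

theory Defs
  imports "HOL-Analysis.Analysis"
begin

(* Convex cones are the library's convex_cone; see convex_cone_iff for the form used in the text:
   0 is an element, closed under addition and under multiplication by nonnegative scalars. *)

definition pointed_convex_cone :: "'a::real_vector set \<Rightarrow> bool" where
  "pointed_convex_cone P \<longleftrightarrow> convex_cone P \<and> P \<inter> uminus ` P = {0}"

(* The cone over S itself, with no convexification. The library's cone hull of the empty set is
   empty, whereas here it is {0}. *)
definition cone_over :: "'a::real_vector set \<Rightarrow> 'a set" where
  "cone_over S = (if S = {} then {0} else {l *\<^sub>R s |l s. 0 \<le> l \<and> s \<in> S})"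

definition gamma1 :: "'a::real_vector \<Rightarrow> 'a \<times> real" where
  "gamma1 x = (x, 1)"

(* Not the set-theoretic difference. *)
definition minkowski_diff :: "'a::real_vector set \<Rightarrow> 'a set \<Rightarrow> 'a set" where
  "minkowski_diff A B = {a - b |a b. a \<in> A \<and> b \<in> B}"

definition preorder_le :: "'a::real_vector set \<Rightarrow> 'a \<Rightarrow> 'a \<Rightarrow> bool" where
  "preorder_le P x y \<longleftrightarrow> y - x \<in> P"

definition min_set :: "'a::real_vector set \<Rightarrow> 'a set \<Rightarrow> 'a set" where
  "min_set P S = {s \<in> S. \<forall>s'\<in>S. preorder_le P s s'}"

definition affine_map :: "('a::real_vector \<Rightarrow> 'b::real_vector) \<Rightarrow> bool" where
  "affine_map f \<longleftrightarrow> (\<exists>L b. linear L \<and> f = (\<lambda>x. L x + b))"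

definition oriented_linear_map ::
    "('w::real_vector \<Rightarrow> 'y::real_vector) \<Rightarrow> 'y set \<Rightarrow> bool" where
  "oriented_linear_map f Yp \<longleftrightarrow> pointed_convex_cone Yp \<and> linear f"

definition oriented_affine_map ::
    "('w::real_vector \<Rightarrow> 'y::real_vector) \<Rightarrow> 'y set \<Rightarrow> bool" where
  "oriented_affine_map f Yp \<longleftrightarrow> pointed_convex_cone Yp \<and> affine_map f"

definition positive_on :: "('w \<Rightarrow> 'y) \<Rightarrow> 'y set \<Rightarrow> 'w set \<Rightarrow> bool" where
  "positive_on f Yp S \<longleftrightarrow> f ` S \<subseteq> Yp"

definition kernel :: "('w \<Rightarrow> 'y::zero) \<Rightarrow> 'w set" where
  "kernel f = f -` {0}"

(* The target Y of an oriented map is an arbitrary real vector space, but HOL cannot quantify over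
   types inside a definition. The existential is therefore taken over one target type that is large
   enough for every face: 'w for linear maps on 'w, and 'x * real for affine maps on 'x.
   The lemmas cone_faceI and convex_faceI below show that faces given by oriented maps into any
   other type 'y are covered, so the restriction is immaterial. *)
definition cone_face :: "'w::real_vector set \<Rightarrow> 'w set \<Rightarrow> bool" where
  "cone_face K F \<longleftrightarrow>
     (\<exists>(f :: 'w \<Rightarrow> 'w) Yp. oriented_linear_map f Yp \<and> positive_on f Yp K \<and> F = K \<inter> kernel f)"

definition convex_face :: "'x::real_vector set \<Rightarrow> 'x set \<Rightarrow> bool" where
  "convex_face C F \<longleftrightarrow>
     (\<exists>(f :: 'x \<Rightarrow> 'x \<times> real) Yp.
        oriented_affine_map f Yp \<and> positive_on f Yp C \<and> F = C \<inter> kernel f)"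

lemma pointed_convex_cone_transport:
  fixes h :: "'z::real_vector \<Rightarrow> 'y::real_vector" and g :: "'y \<Rightarrow> 'z"
  assumes "linear g" "linear h" "\<And>y. y \<in> range h \<Longrightarrow> h (g y) = y" "pointed_convex_cone Yp"
  shows "pointed_convex_cone (g ` (Yp \<inter> range h))"
proof -
  have R: "subspace (range h)"
    using assms(2) by (simp add: linear_subspace_image)
  have Y: "convex_cone Yp" and pt: "Yp \<inter> uminus ` Yp = {0}"
    using assms(4) by (auto simp: pointed_convex_cone_def)
  have "convex_cone (g ` (Yp \<inter> range h))"
  proof (intro convex_cone_linear_image conjI assms(1))
    show "convex_cone (Yp \<inter> range h)"
      using Y R by (auto simp: convex_cone_iff subspace_def)
  qed
  moreover have "z = 0" if "z \<in> g ` (Yp \<inter> range h)" "- z \<in> g ` (Yp \<inter> range h)" for z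
  proof -
    obtain a b where a: "a \<in> Yp" "a \<in> range h" "z = g a" and b: "b \<in> Yp" "b \<in> range h" "- z = g b"
      using \<open>z \<in> _\<close> \<open>- z \<in> _\<close> by blast
    have "b = h (- z)" using b assms(3) by simp
    also have "\<dots> = - a" using a assms(2,3) by (simp add: linear_neg)
    finally have "a = - b" by simp
    then have "a \<in> Yp \<inter> uminus ` Yp" using a(1) b(1) by blast
    then show ?thesis using pt a assms(1) by (auto simp: linear_0)
  qed
  moreover have "0 \<in> g ` (Yp \<inter> range h)"
    using calculation(1) by (simp add: convex_cone_contains_0)
  ultimately show ?thesis
    unfolding pointed_convex_cone_def by (force simp: image_iff[of _ uminus])
qed

lemma cone_faceI:
  fixes f :: "'w::real_vector \<Rightarrow> 'y::real_vector"
  assumes "oriented_linear_map f Yp" "positive_on f Yp K"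
  shows "cone_face K (K \<inter> kernel f)"
proof -
  have f: "linear f" and Yp: "pointed_convex_cone Yp"
    using assms(1) by (auto simp: oriented_linear_map_def)
  obtain g where g: "linear g" "\<And>y. y \<in> range f \<Longrightarrow> f (g y) = y"
    using linear_exists_right_inverse_on[OF f subspace_UNIV] by blast
  have "oriented_linear_map (g \<circ> f) (g ` (Yp \<inter> range f))"
    using pointed_convex_cone_transport[OF g(1) f g(2) Yp] f g(1)
    by (simp add: oriented_linear_map_def linear_compose)
  moreover have "positive_on (g \<circ> f) (g ` (Yp \<inter> range f)) K"
    using assms(2) by (auto simp: positive_on_def)
  moreover have "kernel f = kernel (g \<circ> f)"
    using g f by (auto simp: kernel_def linear_0) (metis linear_0 rangeI)
  ultimately show ?thesis
    unfolding cone_face_def by blast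
qed

lemma convex_faceI:
  fixes f :: "'x::real_vector \<Rightarrow> 'y::real_vector"
  assumes "oriented_affine_map f Yp" "positive_on f Yp C"
  shows "convex_face C (C \<inter> kernel f)"
proof -
  have Yp: "pointed_convex_cone Yp"
    using assms(1) by (auto simp: oriented_affine_map_def)
  obtain L b where L: "linear L" and f: "f = (\<lambda>x. L x + b)"
    using assms(1) by (auto simp: oriented_affine_map_def affine_map_def)
  define h where "h = (\<lambda>p. L (fst p) + snd p *\<^sub>R b)"
  have h: "linear h"
    unfolding h_def using L
    by (intro linearI) (auto simp: linear_add linear_scale algebra_simps)
  have hf: "f x = h (x, 1)" for x
    by (simp add: h_def f)
  obtain g where g: "linear g" "\<And>y. y \<in> range h \<Longrightarrow> h (g y) = y"
    using linear_exists_right_inverse_on[OF h subspace_UNIV] by blast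
  have "linear (g \<circ> L)" "g \<circ> f = (\<lambda>x. (g \<circ> L) x + g b)"
    using g(1) L by (auto simp: f linear_add linear_compose fun_eq_iff)
  then have "affine_map (g \<circ> f)"
    unfolding affine_map_def by blast
  then have "oriented_affine_map (g \<circ> f) (g ` (Yp \<inter> range h))"
    using pointed_convex_cone_transport[OF g(1) h g(2) Yp]
    by (simp add: oriented_affine_map_def)
  moreover have "positive_on (g \<circ> f) (g ` (Yp \<inter> range h)) C"
    using assms(2) hf by (auto simp: positive_on_def)
  moreover have "g (f x) = 0 \<longleftrightarrow> f x = 0" for x
    using g h hf by (metis linear_0 rangeI)
  then have "kernel f = kernel (g \<circ> f)"
    by (simp add: kernel_def vimage_def)
  ultimately show ?thesis
    unfolding convex_face_def by blast
qed

(* Inclusion-smallest set with property P; unlike LEAST below, this includes that it exists. *)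
definition is_smallest_set :: "('a set \<Rightarrow> bool) \<Rightarrow> 'a set \<Rightarrow> bool" where
  "is_smallest_set P F \<longleftrightarrow> P F \<and> (\<forall>F'. P F' \<longrightarrow> F \<subseteq> F')"

definition generated_cone_face :: "'w::real_vector set \<Rightarrow> 'w set \<Rightarrow> 'w set" where
  "generated_cone_face K G = (LEAST F. cone_face K F \<and> K \<inter> G \<subseteq> F)"

definition generated_convex_face :: "'x::real_vector set \<Rightarrow> 'x set \<Rightarrow> 'x set" where
  "generated_convex_face C D = (LEAST F. convex_face C F \<and> C \<inter> D \<subseteq> F)"

end

theory Submission
  imports Defs
begin

text \<open>
  The generated face is \<open>absorbed C D\<close>, the set of all \<open>x \<in> C\<close> such that a half-open
  segment from \<open>x\<close> towards a point of \<open>C\<close> meets \<open>D\<close>. A positive map that vanishes at such a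
  meeting point vanishes at \<open>x\<close>, because its target cone is pointed, so every face that contains
  \<open>C \<inter> D\<close> contains this set. Conversely, an order whose cone \<open>P\<close> is generated by differences
  with \<open>D\<close> becomes pointed modulo the subspace \<open>P \<inter> - P\<close>, and the quotient map exhibits the set
  as a face.
\<close>

section \<open>Cones over sets and homogenization\<close>

lemma convex_cone_cone_over:
  assumes "convex S"
  shows "convex_cone (cone_over S)"
proof (cases "S = {}")
  case False
  then have "cone_over S = conic hull S"
    by (simp add: cone_over_def conic_hull_explicit)
  then show ?thesis
    using False assms
    by (simp add: convex_cone_def convex_conic_hull conic_conic_hull conic_hull_eq_empty)
qed (simp add: cone_over_def convex_cone_iff)

lemma cone_overI: "s \<in> S \<Longrightarrow> 0 \<le> l \<Longrightarrow> l *\<^sub>R s \<in> cone_over S"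
  by (auto simp: cone_over_def)

lemma cone_over_superset: "s \<in> S \<Longrightarrow> s \<in> cone_over S"
  using cone_overI[of s S 1] by simp

text \<open>The last coordinate fixes the scalar to be \<open>t\<close>. Positivity of
  \<open>t\<close> also rules out the default cone {0} of an empty \<open>S\<close>.\<close>

lemma mem_cone_over_lift_iff:
  assumes "t > 0"
  shows "(x, t) \<in> cone_over (S \<times> {1}) \<longleftrightarrow> (1 / t) *\<^sub>R x \<in> S"
proof
  assume "(x, t) \<in> cone_over (S \<times> {1})"
  then show "(1 / t) *\<^sub>R x \<in> S"
    using assms by (auto simp: cone_over_def zero_prod_def split: if_splits)
next
  assume "(1 / t) *\<^sub>R x \<in> S"
  then have "t *\<^sub>R ((1 / t) *\<^sub>R x, 1 :: real) \<in> cone_over (S \<times> {1})"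
    using assms by (intro cone_overI) auto
  then show "(x, t) \<in> cone_over (S \<times> {1})" using assms by simp
qed

lemma cone_over_lift:
  assumes "S \<noteq> {}"
  shows "cone_over (S \<times> {1 :: real}) = {(m *\<^sub>R c, m) |m c. 0 \<le> m \<and> c \<in> S}"
  using assms by (auto simp: cone_over_def)

lemma minkowski_diff_eq_UN: "minkowski_diff A B = (\<Union>a\<in>A. \<Union>b\<in>B. {a - b})"
  by (auto simp: minkowski_diff_def)

lemma convex_minkowski_diff: "convex A \<Longrightarrow> convex B \<Longrightarrow> convex (minkowski_diff A B)"
  unfolding minkowski_diff_eq_UN by (rule convex_differences)

section \<open>Pointed cones and the quotient by the lineality space\<close>

lemma pointed_convex_cone_eq_0:
  assumes "pointed_convex_cone P" "a \<in> P" "b \<in> P" "a + b = 0"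
  shows "a = 0"
proof -
  have "a = - b" using assms(4) by (simp only: eq_neg_iff_add_eq_0)
  then have "a \<in> P \<inter> uminus ` P" using assms(2,3) by blast
  moreover have "P \<inter> uminus ` P = {0}" using assms(1) by (simp only: pointed_convex_cone_def)
  ultimately show ?thesis by (simp only: singleton_iff)
qed

lemma convex_cone_pointed_quotient:
  fixes P :: "'w::real_vector set"
  assumes P: "convex_cone P"
  obtains f :: "'w \<Rightarrow> 'w" where
    "linear f" "pointed_convex_cone (f ` P)" "kernel f = P \<inter> uminus ` P"
proof -
  define L where "L = P \<inter> uminus ` P"
  have mem_L: "x \<in> L \<longleftrightarrow> x \<in> P \<and> - x \<in> P" for x
    by (force simp: L_def image_iff)
  note P' = P[unfolded convex_cone_iff]
  have "convex_cone L"
    unfolding convex_cone_iff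
  proof (intro conjI ballI allI impI)
    fix x y assume "x \<in> L" "y \<in> L"
    then have "x + y \<in> P" "- x + - y \<in> P" using P' by (simp_all only: mem_L)
    then show "x + y \<in> L" by (simp add: mem_L)
  next
    fix x and c :: real assume "x \<in> L" "0 \<le> c"
    then have "c *\<^sub>R x \<in> P" "c *\<^sub>R (- x) \<in> P" using P' by (simp_all only: mem_L)
    then show "c *\<^sub>R x \<in> L" by (simp add: mem_L)
  qed (use P' in \<open>simp add: mem_L\<close>)
  then have L: "subspace L" by (simp add: subspace_convex_cone_symmetric mem_L)
  \<comment> \<open>A linear left inverse of the identity on \<open>L\<close> with values in
    \<open>L\<close> is a projection onto \<open>L\<close>.\<close>
  obtain g where g: "range g \<subseteq> L" "linear g" "\<And>v. v \<in> L \<Longrightarrow> g v = v"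
    using linear_exists_left_inverse_on[OF linear_id L] by auto
  define f where "f = (\<lambda>x. x - g x)"
  have f: "linear f"
    unfolding f_def by (intro linear_compose_sub g linear_ident)
  have f0: "f x = 0 \<longleftrightarrow> x \<in> L" for x
    using g(1) g(3)[of x] by (metis f_def eq_iff_diff_eq_0 rangeI subsetD)
  have cone: "convex_cone (f ` P)"
    using f P by (simp add: convex_cone_linear_image)
  have "f p = 0" if "p \<in> P" "q \<in> P" "f p = - f q" for p q
  proof -
    have "f (p + q) = 0" using that f by (simp add: linear_add)
    \<comment> \<open>Since \<open>p + q\<close> lies in \<open>L\<close>, its negative lies in
      \<open>P\<close>; adding \<open>q\<close> leaves \<open>- p\<close>.\<close>
    then have "q + - (p + q) \<in> P" using f0 mem_L that P' by blast
    then have "- p \<in> P" by simp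
    then show ?thesis using f0 mem_L that(1) by blast
  qed
  then have "f ` P \<inter> uminus ` f ` P \<subseteq> {0}" by auto
  moreover have "0 \<in> f ` P" using cone by (simp add: convex_cone_contains_0)
  ultimately have "pointed_convex_cone (f ` P)"
    unfolding pointed_convex_cone_def using cone by force
  with f f0 show thesis
    by (intro that[of f]) (auto simp: kernel_def L_def)
qed

section \<open>Faces of convex sets and of cones\<close>

lemma convex_face_absorbs:
  assumes "convex_face C F" "x \<in> C" "c \<in> C" "0 \<le> m" "(1 / (1 + m)) *\<^sub>R (x + m *\<^sub>R c) \<in> F"
  shows "x \<in> F"
proof -
  obtain f :: "'a \<Rightarrow> 'a \<times> real" and Yp where f: "oriented_affine_map f Yp" "positive_on f Yp C"
    and F: "F = C \<inter> kernel f"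
    using assms(1) unfolding convex_face_def by blast
  obtain L b where L: "linear L" and fL: "f = (\<lambda>x. L x + b)" and Yp: "pointed_convex_cone Yp"
    using f(1) by (auto simp: oriented_affine_map_def affine_map_def)
  have "0 = (1 + m) *\<^sub>R f ((1 / (1 + m)) *\<^sub>R (x + m *\<^sub>R c))"
    using assms(5) F by (simp add: kernel_def)
  also have "\<dots> = (1 + m) *\<^sub>R (1 / (1 + m)) *\<^sub>R (L x + m *\<^sub>R L c) + (1 + m) *\<^sub>R b"
    by (simp only: fL linear_add[OF L] linear_scale[OF L] scaleR_add_right)
  \<comment> \<open>The constant term splits as \<open>b + m *\<^sub>R b\<close>, which completes
    \<open>L x\<close> and \<open>m *\<^sub>R L c\<close> to values of \<open>f\<close>. Both
    summands lie in the pointed cone \<open>Yp\<close>.\<close>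
  also have "\<dots> = f x + m *\<^sub>R f c"
    using assms(4) by (simp add: fL scaleR_add_right scaleR_add_left)
  finally have "f x + m *\<^sub>R f c = 0" by simp
  moreover have "f x \<in> Yp" "m *\<^sub>R f c \<in> Yp"
    using f(2) Yp assms(2-4) by (auto simp: positive_on_def pointed_convex_cone_def convex_cone_iff)
  ultimately have "f x = 0" using pointed_convex_cone_eq_0[OF Yp] by blast
  then show ?thesis using F assms(2) by (simp add: kernel_def)
qed

lemma cone_face_absorbs:
  assumes "cone_face K F" "x \<in> K" "k \<in> K" "x + k \<in> F"
  shows "x \<in> F"
proof -
  obtain f :: "'a \<Rightarrow> 'a" and Yp where f: "linear f" "pointed_convex_cone Yp" "f ` K \<subseteq> Yp"
    and F: "F = K \<inter> kernel f"
    using assms(1) by (auto simp: cone_face_def oriented_linear_map_def positive_on_def)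
  have "f x + f k = 0" using assms(4) F f(1) by (simp add: kernel_def linear_add)
  then have "f x = 0" using pointed_convex_cone_eq_0[OF f(2)] f(3) assms(2,3) by blast
  then show ?thesis using F assms(2) by (simp add: kernel_def)
qed

text \<open>A positive constant map has empty kernel; this serves the case where \<open>C\<close>
  and \<open>D\<close> are disjoint.\<close>

lemma convex_face_empty: "convex_face C {}"
proof -
  have "pointed_convex_cone {0 :: real..}"
    by (auto simp: pointed_convex_cone_def convex_cone_iff)
  moreover have "affine_map (\<lambda>x :: 'a. 1 :: real)"
    unfolding affine_map_def by (intro exI[of _ "\<lambda>_. 0"] exI[of _ 1]) (simp add: linear_zero)
  ultimately have "convex_face C (C \<inter> kernel (\<lambda>x. 1 :: real))"
    by (intro convex_faceI[of _ "{0..}"]) (auto simp: oriented_affine_map_def positive_on_def)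
  then show ?thesis by (simp add: kernel_def)
qed

text \<open>The point \<open>e\<close> is itself a least element of \<open>C\<close>, so the others
  are exactly those \<open>x\<close> equivalent to it, with \<open>x - e\<close> in the lineality
  space. The quotient map applied to \<open>x - e\<close> vanishes precisely there.\<close>

lemma convex_face_min_set:
  fixes C :: "'x::real_vector set"
  assumes P: "convex_cone P" and e: "e \<in> C" "\<And>c. c \<in> C \<Longrightarrow> c - e \<in> P"
  shows "convex_face C (min_set P C)"
proof -
  obtain f :: "'x \<Rightarrow> 'x" where f: "linear f" "pointed_convex_cone (f ` P)"
    and ker: "kernel f = P \<inter> uminus ` P"
    using convex_cone_pointed_quotient[OF P] .
  have "convex_face C (C \<inter> kernel (\<lambda>x. f (x - e)))"
  proof (rule convex_faceI[of _ "f ` P"])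
    show "oriented_affine_map (\<lambda>x. f (x - e)) (f ` P)"
      unfolding oriented_affine_map_def affine_map_def using f
      by (auto simp: linear_diff intro!: exI[of _ f] exI[of _ "- f e"])
  qed (use e in \<open>auto simp: positive_on_def\<close>)
  also have "C \<inter> kernel (\<lambda>x. f (x - e)) = min_set P C"
  proof -
    have k: "f (x - e) = 0 \<longleftrightarrow> e - x \<in> P" if "x \<in> C" for x
    proof -
      have "f (x - e) = 0 \<longleftrightarrow> x - e \<in> P \<inter> uminus ` P" using ker by (auto simp: kernel_def)
      also have "\<dots> \<longleftrightarrow> e - x \<in> P" using e(2)[OF that]
        by (metis Int_iff imageE imageI minus_diff_eq minus_minus)
      finally show ?thesis .
    qed
    have "s - x \<in> P" if "e - x \<in> P" "s \<in> C" for x s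
    proof -
      have "(s - e) + (e - x) \<in> P" using that e(2) P by (simp only: convex_cone_iff)
      then show ?thesis by simp
    qed
    then show ?thesis
      using e(1) k by (auto simp: kernel_def min_set_def preorder_le_def)
  qed
  finally show ?thesis .
qed

section \<open>The generated face of a convex set\<close>

text \<open>The weight ratio \<open>m\<close> runs over all nonnegative reals, so the point moves
  from \<open>x\<close> (at \<open>m = 0\<close>) towards \<open>c\<close> without reaching it. This
  choice matches the sum \<open>(x, 1) + m *\<^sub>R (c, 1)\<close> in the homogenization.\<close>

definition absorbed :: "'x::real_vector set \<Rightarrow> 'x set \<Rightarrow> 'x set" where
  "absorbed C D = {x \<in> C. \<exists>c\<in>C. \<exists>m\<ge>0. (1 / (1 + m)) *\<^sub>R (x + m *\<^sub>R c) \<in> D}"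

lemma convex_weighted_mean:
  assumes "convex C" "x \<in> C" "c \<in> C" "0 \<le> m"
  shows "(1 / (1 + m)) *\<^sub>R (x + m *\<^sub>R c) \<in> C"
proof -
  have "(1 / (1 + m)) *\<^sub>R x + (m / (1 + m)) *\<^sub>R c \<in> C"
    using assms by (intro convexD) (auto simp: add_divide_distrib[symmetric])
  then show ?thesis by (simp add: scaleR_add_right)
qed

lemma Int_subset_absorbed: "C \<inter> D \<subseteq> absorbed C D"
proof
  fix x assume "x \<in> C \<inter> D"
  then have "x \<in> C" "(1 / (1 + 0)) *\<^sub>R (x + 0 *\<^sub>R x) \<in> D" by simp_all
  then show "x \<in> absorbed C D" unfolding absorbed_def by blast
qed

lemma absorbed_Int:
  assumes "convex C"
  shows "absorbed C (C \<inter> D) = absorbed C D"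
proof -
  have "(1 / (1 + m)) *\<^sub>R (x + m *\<^sub>R c) \<in> C \<inter> D \<longleftrightarrow> (1 / (1 + m)) *\<^sub>R (x + m *\<^sub>R c) \<in> D"
    if "x \<in> C" "c \<in> C" "0 \<le> m" for x c m
    using convex_weighted_mean[OF assms that] by blast
  then show ?thesis unfolding absorbed_def by meson
qed

lemma absorbed_empty_iff: "convex C \<Longrightarrow> absorbed C D = {} \<longleftrightarrow> C \<inter> D = {}"
  using Int_subset_absorbed[of C D] absorbed_Int[of C D] by (auto simp: absorbed_def)

text \<open>Convexity places the meeting point in \<open>C \<inter> D\<close>, hence in
  \<open>F\<close>, and \<open>F\<close> then absorbs \<open>x\<close>.\<close>

lemma absorbed_subset_convex_face:
  assumes "convex C" "convex_face C F" "C \<inter> D \<subseteq> F"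
  shows "absorbed C D \<subseteq> F"
proof
  fix x assume "x \<in> absorbed C D"
  then obtain c m where x: "x \<in> C" "c \<in> C" "0 \<le> m" "(1 / (1 + m)) *\<^sub>R (x + m *\<^sub>R c) \<in> D"
    by (auto simp: absorbed_def)
  moreover have "(1 / (1 + m)) *\<^sub>R (x + m *\<^sub>R c) \<in> F"
    using convex_weighted_mean[OF assms(1) x(1-3)] x(4) assms(3) by blast
  ultimately show "x \<in> F" using convex_face_absorbs[OF assms(2)] by blast
qed

text \<open>Comparing \<open>x\<close> with one common point \<open>e\<close> suffices:
  \<open>e - x = l *\<^sub>R (c - d)\<close> rearranges to
  \<open>x + l *\<^sub>R c = e + l *\<^sub>R d\<close>, and dividing by \<open>1 + l\<close> gives a
  mean of two points of \<open>D\<close>. Conversely, a meeting point \<open>d\<close> lies below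
  every \<open>s\<close> in \<open>C\<close> and above \<open>x\<close>, so \<open>x\<close> is
  below \<open>s\<close>.\<close>

lemma min_set_eq_absorbed:
  assumes C: "convex C" and D: "convex D" and ne: "C \<inter> D \<noteq> {}"
  shows "min_set (cone_over (minkowski_diff C D)) C = absorbed C D"
proof
  let ?P = "cone_over (minkowski_diff C D)"
  obtain e where e: "e \<in> C" "e \<in> D" using ne by blast
  show "min_set ?P C \<subseteq> absorbed C D"
  proof
    fix x assume x: "x \<in> min_set ?P C"
    then have "x \<in> C" and "e - x \<in> ?P" using e by (auto simp: min_set_def preorder_le_def)
    moreover have "minkowski_diff C D \<noteq> {}" using e by (auto simp: minkowski_diff_def)
    ultimately obtain l v where l: "0 \<le> l" "v \<in> minkowski_diff C D" "e - x = l *\<^sub>R v"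
      unfolding cone_over_def by auto
    then obtain c d where v: "c \<in> C" "d \<in> D" "v = c - d"
      unfolding minkowski_diff_def by blast
    have "x + l *\<^sub>R c = e + l *\<^sub>R d" using l(3) v by (simp add: algebra_simps)
    then have "(1 / (1 + l)) *\<^sub>R (x + l *\<^sub>R c) \<in> D"
      using convex_weighted_mean[OF D e(2) v(2) l(1)] by simp
    then show "x \<in> absorbed C D" using \<open>x \<in> C\<close> l v by (auto simp: absorbed_def)
  qed
  show "absorbed C D \<subseteq> min_set ?P C"
  proof
    fix x assume "x \<in> absorbed C D"
    then obtain c m where x: "x \<in> C" "c \<in> C" "0 \<le> m" and "(1 / (1 + m)) *\<^sub>R (x + m *\<^sub>R c) \<in> D"
      by (auto simp: absorbed_def)
    then obtain d where d: "d \<in> D" "d = (1 / (1 + m)) *\<^sub>R (x + m *\<^sub>R c)" by blast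
    have "(1 + m) *\<^sub>R d = x + m *\<^sub>R c" using d(2) x(3) by simp
    then have dx: "d - x = m *\<^sub>R (c - d)" by (simp add: algebra_simps)
    have "s - x \<in> ?P" if "s \<in> C" for s
    proof -
      have "s - d \<in> minkowski_diff C D" "c - d \<in> minkowski_diff C D"
        using that d(1) x by (auto simp: minkowski_diff_def)
      then have "s - d \<in> ?P" "m *\<^sub>R (c - d) \<in> ?P"
        using x(3) cone_overI cone_over_superset by blast+
      moreover have "s - x = (s - d) + m *\<^sub>R (c - d)" unfolding dx[symmetric] by simp
      ultimately show ?thesis
        using convex_cone_cone_over[OF convex_minkowski_diff[OF C D]] by (simp only: convex_cone_iff)
    qed
    then show "x \<in> min_set ?P C" using x by (auto simp: min_set_def preorder_le_def)
  qed
qed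

lemma is_smallest_convex_face_absorbed:
  assumes C: "convex C" and D: "convex D"
  shows "is_smallest_set (\<lambda>F. convex_face C F \<and> C \<inter> D \<subseteq> F) (absorbed C D)"
proof -
  have "convex_face C (absorbed C D)"
  proof (cases "C \<inter> D = {}")
    case True
    then show ?thesis using absorbed_empty_iff[OF C, of D] convex_face_empty by simp
  next
    case False
    then obtain e where "e \<in> C" "e \<in> D" by blast
    \<comment> \<open>Any common point \<open>e\<close> serves as the least element, because
      \<open>c - e\<close> is a difference of a point of \<open>C\<close> and a point of
      \<open>D\<close>.\<close>
    then show ?thesis
      using False unfolding min_set_eq_absorbed[OF C D False, symmetric]
      by (intro convex_face_min_set[of _ e] convex_cone_cone_over convex_minkowski_diff C D)
        (auto intro!: cone_over_superset simp: minkowski_diff_def)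
  qed
  then show ?thesis
    using Int_subset_absorbed absorbed_subset_convex_face[OF C] by (auto simp: is_smallest_set_def)
qed

section \<open>The generated face of a cone and its dehomogenization\<close>

text \<open>The order is given by the cone \<open>K - G\<close>, which contains \<open>K\<close>.
  For \<open>z\<close> in \<open>K\<close>, being in its lineality space means
  \<open>- z = k - g\<close>, that is, \<open>z + k\<close> lies in \<open>G\<close>. Minimality
  holds because \<open>z + k\<close> is then in \<open>K \<inter> G\<close>, so each competing face
  absorbs \<open>z\<close>.\<close>

lemma is_smallest_cone_face:
  fixes K G :: "'w::real_vector set"
  assumes K: "convex_cone K" and G: "convex_cone G"
  shows "is_smallest_set (\<lambda>F. cone_face K F \<and> K \<inter> G \<subseteq> F) {z \<in> K. \<exists>k\<in>K. z + k \<in> G}"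
    (is "is_smallest_set _ ?F")
proof -
  define P where "P = minkowski_diff K G"
  have "P = (\<Union>x\<in>K. \<Union>y\<in>uminus ` G. {x + y})" by (auto simp: P_def minkowski_diff_def)
  then have P: "convex_cone P" using convex_cone_sums[OF K convex_cone_negations[OF G]] by simp
  have KP: "K \<subseteq> P"
    using convex_cone_contains_0[OF G] by (force simp: P_def minkowski_diff_def)
  obtain f :: "'w \<Rightarrow> 'w" where f: "linear f" "pointed_convex_cone (f ` P)"
    and ker: "kernel f = P \<inter> uminus ` P"
    using convex_cone_pointed_quotient[OF P] .
  have "cone_face K (K \<inter> kernel f)"
    using f KP by (intro cone_faceI[of _ "f ` P"]) (auto simp: oriented_linear_map_def positive_on_def)
  also have "K \<inter> kernel f = ?F"
  proof -
    have "- z \<in> P \<longleftrightarrow> (\<exists>k\<in>K. z + k \<in> G)" for z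
    proof -
      have "- z = k - g \<longleftrightarrow> g = z + k" for k g by (auto simp: algebra_simps)
      then show ?thesis by (auto simp: P_def minkowski_diff_def)
    qed
    moreover have "z \<in> uminus ` P \<longleftrightarrow> - z \<in> P" for z by (force simp: image_iff)
    ultimately show ?thesis using ker KP by auto
  qed
  finally have "cone_face K ?F" .
  moreover have "K \<inter> G \<subseteq> ?F"
    using convex_cone_contains_0[OF K] by force
  moreover have "?F \<subseteq> F" if "cone_face K F" "K \<inter> G \<subseteq> F" for F
    using that convex_cone_add[OF K] cone_face_absorbs[OF that(1)] by blast
  ultimately show ?thesis unfolding is_smallest_set_def by meson
qed

lemma is_smallest_set_imp_Least: "is_smallest_set Q F \<Longrightarrow> (LEAST F. Q F) = F"
  unfolding is_smallest_set_def by (intro Least_equality) auto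

text \<open>An element of \<open>K\<close> has the form \<open>(m *\<^sub>R c, m)\<close>. Added to
  \<open>(x, 1)\<close> it has height \<open>1 + m > 0\<close>, so membership in \<open>G\<close>
  can be tested by rescaling to height 1.\<close>

lemma gamma1_vimage_cone_face:
  fixes C D :: "'x::real_vector set"
  defines "K \<equiv> cone_over (C \<times> {1 :: real})" and "G \<equiv> cone_over (D \<times> {1 :: real})"
  shows "gamma1 -` {z \<in> K. \<exists>k\<in>K. z + k \<in> G} = absorbed C D"
proof -
  have mem_K: "(x, 1) \<in> K \<longleftrightarrow> x \<in> C" for x
    using mem_cone_over_lift_iff[of 1 x C] by (simp add: K_def)
  have "(\<exists>k\<in>K. (x, 1) + k \<in> G) \<longleftrightarrow> (\<exists>c\<in>C. \<exists>m\<ge>0. (1 / (1 + m)) *\<^sub>R (x + m *\<^sub>R c) \<in> D)"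
    if "x \<in> C" for x
  proof -
    \<comment> \<open>The explicit form of the cone fails for the empty set, whose cone is {0} by
      convention.\<close>
    have "C \<noteq> {}" using that by blast
    then have "(\<exists>k\<in>K. (x, 1) + k \<in> G) \<longleftrightarrow> (\<exists>c\<in>C. \<exists>m\<ge>0. (x + m *\<^sub>R c, 1 + m) \<in> G)"
      unfolding K_def by (subst cone_over_lift) auto
    also have "\<dots> \<longleftrightarrow> (\<exists>c\<in>C. \<exists>m\<ge>0. (1 / (1 + m)) *\<^sub>R (x + m *\<^sub>R c) \<in> D)"
      unfolding G_def by (intro bex_cong refl ex_cong1 conj_cong mem_cone_over_lift_iff) simp
    finally show ?thesis .
  qed
  then show ?thesis
    unfolding gamma1_def absorbed_def vimage_def mem_Collect_eq mem_K
    by (intro Collect_cong conj_cong refl)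
qed

theorem theorem5p12:
  fixes C D :: "'x::real_vector set" and K G :: "('x \<times> real) set"
  assumes "convex C" and "convex D"
    and "K = cone_over (C \<times> {1})" and "G = cone_over (D \<times> {1})"
  shows "is_smallest_set (\<lambda>F. cone_face K F \<and> K \<inter> G \<subseteq> F) (generated_cone_face K G)
    \<and> is_smallest_set (\<lambda>F. convex_face C F \<and> C \<inter> D \<subseteq> F) (generated_convex_face C D)
    \<and> generated_convex_face C D = gamma1 -` generated_cone_face K G
    \<and> generated_convex_face C D =
        (if C \<inter> D \<noteq> {} then min_set (cone_over (minkowski_diff C D)) C else {})
    \<and> generated_convex_face C D =
        (if C \<inter> D \<noteq> {} then min_set (cone_over (minkowski_diff C (C \<inter> D))) C else {})"
proof -
  have "convex_cone K" "convex_cone G"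
    using assms by (auto intro!: convex_cone_cone_over convex_Times)
  note cone = is_smallest_cone_face[OF this]
  note conv = is_smallest_convex_face_absorbed[OF assms(1,2)]
  have gc: "generated_cone_face K G = {z \<in> K. \<exists>k\<in>K. z + k \<in> G}"
    using is_smallest_set_imp_Least[OF cone] by (simp add: generated_cone_face_def)
  have gf: "generated_convex_face C D = absorbed C D"
    using is_smallest_set_imp_Least[OF conv] by (simp add: generated_convex_face_def)
  have "absorbed C D = gamma1 -` generated_cone_face K G"
    unfolding gc using gamma1_vimage_cone_face[of C D] assms(3,4) by simp
  moreover have "absorbed C D = (if C \<inter> D \<noteq> {} then min_set (cone_over (minkowski_diff C D)) C else {})"
    using min_set_eq_absorbed[OF assms(1,2)] absorbed_empty_iff[OF assms(1), of D] by auto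
  moreover have "absorbed C D =
      (if C \<inter> D \<noteq> {} then min_set (cone_over (minkowski_diff C (C \<inter> D))) C else {})"
    \<comment> \<open>The fourth set is the third one for the convex set \<open>C \<inter> D\<close>
      in place of \<open>D\<close>, a replacement that leaves \<open>absorbed\<close>
      unchanged.\<close>
    using min_set_eq_absorbed[OF assms(1) convex_Int[OF assms(1,2)]]
      absorbed_Int[OF assms(1), of D] absorbed_empty_iff[OF assms(1), of D] by auto
  ultimately show ?thesis
    using cone conv by (simp only: gc gf)
qed

end
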